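(* Let $Y=\{0,1\}^{\mathbb Z}$, let $\sigma\colon Y\to Y$ be the shift $(\sigma(\alpha))_i=\alpha_{i+1}$, let $\mu\in Y$ be the sequence with all entries $0$, and for $n\ge 0$ let $U_n=\{\alpha\in Y\mid\alpha_i=0\text{ for }|i|<n\}$ (so $U_0=Y$). Let $X=\{(n,\alpha)\in\mathbb N\times Y\mid\alpha\in U_n\}$ and define partial homeomorphisms $f,g$ of $X$ by $f(n,\alpha)=(n,\sigma(\alpha))$ with $\mathrm{dom} f=\{(n,\alpha)\in X\mid\sigma(\alpha)\in U_n\setminus U_{n+2}\}$, and $g(n,\alpha)=(n+1,\alpha)$ with $\mathrm{dom}\,g=\{(n,\alpha)\in X\mid\alpha\in U_{n+1}\}$. Let $\mathcal G$ be the pseudogroup on $X$ generated by $f$ and $g$. Then $(0,\mu)$ is a point of equicontinuity for $\mathcal G$.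
   Context: $\mathbb N$ contains $0$ and is discrete; $Y$ has the product topology and $X$ the subspace topology of $\mathbb N\times Y$. Metrics may take the value $\infty$; a metric is compatible if its open balls generate the topology. $\mathrm{Ph}(X)$ is the set of partial homeomorphisms of $X$, i.e. homeomorphisms $f\colon\mathrm{dom} f\to\mathrm{im} f$ between open subsets of $X$; the composition $gf$ has domain $f^{-1}(\mathrm{dom}\,g)$. A pseudo$*$group on $X$ is a subset of $\mathrm{Ph}(X)$ containing $\mathrm{id}_X$ and closed under inversion, composition and restriction to open subsets of domains. A pseudogroup is a pseudo$*$group $\mathcal G$ such that if $f\in\mathrm{Ph}(X)$ and every $x\in\mathrm{dom} f$ has an open neighborhood $U_x$ with $f|_{U_x}\in\mathcal G$, then $f\in\mathcal G$. $S\subset\mathcal G$ generates $\mathcal G$ if $\mathcal G$ is the smallest pseudogroup containing $S$; $S^*$ is the smallest pseudo$*$group containing $S$. A point $x$ is $(S,d)$-equicontinuous, for a generating set $S$ of $\mathcal G$ and a compatible metric $d$ on $X$, if for every $\epsilon>0$ there is $\delta(\epsilon)>0$ such that $d(x,y)<\delta(\epsilon)$ implies $d(s(x),s(y))<\epsilon$ for every $s\in S^*$ and $y\in X$ with $x,y\in\mathrm{dom}\,s$. A point $x$ is a point of equicontinuity (equicontinuous) for $\mathcal G$ if it is $(S,d)$-equicontinuous for some choice of $S$ and $d$. *)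

theory Defs
  imports "HOL-Analysis.Analysis"
begin

section \<open>Partial homeomorphisms and pseudogroups\<close>

text \<open>
  A partial homeomorphism is an element of \<open>'a \<rightharpoonup> 'a\<close>; equality of partial maps then includes equality
  of domains, \<open>g \<circ>\<^sub>m f\<close> is the composition on \<open>f\<^sup>-\<^sup>1(dom g)\<close>, and \<open>f |` U\<close> is the restriction.
\<close>

definition partial_homeos :: "'a topology \<Rightarrow> ('a \<rightharpoonup> 'a) set" where
  "partial_homeos T =
     {f. openin T (dom f) \<and> openin T (ran f) \<and>
         homeomorphic_map (subtopology T (dom f)) (subtopology T (ran f)) (\<lambda>x. the (f x))}"

definition pmap_id :: "'a topology \<Rightarrow> 'a \<rightharpoonup> 'a" where
  "pmap_id T = (\<lambda>x. if x \<in> topspace T then Some x else None)"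

text \<open>Only meaningful for injective partial maps.\<close>

definition pmap_inv :: "('a \<rightharpoonup> 'b) \<Rightarrow> ('b \<rightharpoonup> 'a)" where
  "pmap_inv f = (\<lambda>y. if y \<in> ran f then Some (THE x. f x = Some y) else None)"

definition pseudostargroup :: "'a topology \<Rightarrow> ('a \<rightharpoonup> 'a) set \<Rightarrow> bool" where
  "pseudostargroup T G \<longleftrightarrow>
     G \<subseteq> partial_homeos T \<and>
     pmap_id T \<in> G \<and>
     (\<forall>f\<in>G. pmap_inv f \<in> G) \<and>
     (\<forall>f\<in>G. \<forall>g\<in>G. g \<circ>\<^sub>m f \<in> G) \<and>
     (\<forall>f\<in>G. \<forall>U. openin T U \<and> U \<subseteq> dom f \<longrightarrow> f |` U \<in> G)"

definition pseudogroup :: "'a topology \<Rightarrow> ('a \<rightharpoonup> 'a) set \<Rightarrow> bool" where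
  "pseudogroup T G \<longleftrightarrow>
     pseudostargroup T G \<and>
     (\<forall>f\<in>partial_homeos T.
        (\<forall>x\<in>dom f. \<exists>U. openin T U \<and> x \<in> U \<and> U \<subseteq> dom f \<and> f |` U \<in> G) \<longrightarrow> f \<in> G)"

text \<open>
  The smallest pseudogroup containing \<open>S\<close> is \<open>pseudogroup T hull S\<close>, and \<open>S\<^sup>*\<close> is
  \<open>pseudostargroup T hull S\<close>. These are intersections of families that contain \<open>partial_homeos T\<close>
  as soon as \<open>S \<subseteq> partial_homeos T\<close>; for other \<open>S\<close> the families are empty and the hulls are \<open>UNIV\<close>,
  hence the first conjunct below.
\<close>

definition generates :: "'a topology \<Rightarrow> ('a \<rightharpoonup> 'a) set \<Rightarrow> ('a \<rightharpoonup> 'a) set \<Rightarrow> bool" where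
  "generates T S G \<longleftrightarrow> S \<subseteq> partial_homeos T \<and> G = pseudogroup T hull S"

section \<open>Equicontinuity\<close>

definition extended_metric :: "'a set \<Rightarrow> ('a \<Rightarrow> 'a \<Rightarrow> ennreal) \<Rightarrow> bool" where
  "extended_metric M d \<longleftrightarrow>
     (\<forall>x\<in>M. \<forall>y\<in>M. d x y = 0 \<longleftrightarrow> x = y) \<and>
     (\<forall>x\<in>M. \<forall>y\<in>M. d x y = d y x) \<and>
     (\<forall>x\<in>M. \<forall>y\<in>M. \<forall>z\<in>M. d x z \<le> d x y + d y z)"

definition compatible_metric :: "'a topology \<Rightarrow> ('a \<Rightarrow> 'a \<Rightarrow> ennreal) \<Rightarrow> bool" where
  "compatible_metric T d \<longleftrightarrow>
     extended_metric (topspace T) d \<and>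
     topology_generated_by
       {{y \<in> topspace T. d x y < ennreal r} | x r. x \<in> topspace T \<and> (0::real) < r} = T"

definition equicontinuous_wrt ::
    "'a topology \<Rightarrow> ('a \<rightharpoonup> 'a) set \<Rightarrow> ('a \<Rightarrow> 'a \<Rightarrow> ennreal) \<Rightarrow> 'a \<Rightarrow> bool" where
  "equicontinuous_wrt T S d x \<longleftrightarrow>
     (\<forall>\<epsilon>::real. 0 < \<epsilon> \<longrightarrow>
        (\<exists>\<delta>::real. 0 < \<delta> \<and>
           (\<forall>s \<in> pseudostargroup T hull S. \<forall>y \<in> topspace T.
              x \<in> dom s \<and> y \<in> dom s \<and> d x y < ennreal \<delta> \<longrightarrow>
              d (the (s x)) (the (s y)) < ennreal \<epsilon>)))"

definition equicontinuity_point :: "'a topology \<Rightarrow> ('a \<rightharpoonup> 'a) set \<Rightarrow> 'a \<Rightarrow> bool" where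
  "equicontinuity_point T G x \<longleftrightarrow>
     x \<in> topspace T \<and>
     (\<exists>S d. generates T S G \<and> compatible_metric T d \<and> equicontinuous_wrt T S d x)"

section \<open>The space and the two partial maps\<close>

definition Ytop :: "(int \<Rightarrow> nat) topology" where
  "Ytop = product_topology (\<lambda>_. discrete_topology {0, 1}) UNIV"

definition shift :: "(int \<Rightarrow> nat) \<Rightarrow> (int \<Rightarrow> nat)" where
  "shift \<alpha> = (\<lambda>i. \<alpha> (i + 1))"

definition zero_seq :: "int \<Rightarrow> nat" where
  "zero_seq = (\<lambda>_. 0)"

definition zero_cyl :: "nat \<Rightarrow> (int \<Rightarrow> nat) set" where
  "zero_cyl n = {\<alpha> \<in> topspace Ytop. \<forall>i. \<bar>i\<bar> < int n \<longrightarrow> \<alpha> i = 0}"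

definition Xtop :: "(nat \<times> (int \<Rightarrow> nat)) topology" where
  "Xtop = subtopology (prod_topology (discrete_topology UNIV) Ytop) {(n, \<alpha>). \<alpha> \<in> zero_cyl n}"

definition shift_map :: "nat \<times> (int \<Rightarrow> nat) \<rightharpoonup> nat \<times> (int \<Rightarrow> nat)" where
  "shift_map = (\<lambda>(n, \<alpha>).
     if (n, \<alpha>) \<in> topspace Xtop \<and> shift \<alpha> \<in> zero_cyl n - zero_cyl (n + 2)
     then Some (n, shift \<alpha>) else None)"

definition lift_map :: "nat \<times> (int \<Rightarrow> nat) \<rightharpoonup> nat \<times> (int \<Rightarrow> nat)" where
  "lift_map = (\<lambda>(n, \<alpha>).
     if (n, \<alpha>) \<in> topspace Xtop \<and> \<alpha> \<in> zero_cyl (n + 1)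
     then Some (n + 1, \<alpha>) else None)"

end

theory Submission
  imports Defs
begin

text \<open>
  The orbit of \<open>(0, \<mu>)\<close>, where \<open>\<mu>\<close> is \<^const>\<open>zero_seq\<close>, only moves through the points \<open>(k, \<mu>)\<close>,
  because \<^const>\<open>shift_map\<close> and its inverse avoid \<open>\<mu>\<close>: a sequence outside \<open>zero_cyl (n + 2)\<close> is not \<open>\<mu>\<close>.
  A composite of the generators that is defined at \<open>(0, \<mu>)\<close> is therefore a composite of
  \<^const>\<open>lift_map\<close> and its inverse alone, and on the level \<open>0\<close> it acts as
  \<open>(0, \<beta>) \<mapsto> (k, \<beta>)\<close> with one and the same \<open>k\<close>. For a metric that puts different levels
  at distance \<open>\<infinity>\<close> and restricts on every level to one fixed metric of \<open>Y\<close>, such a map preserves the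
  distance to \<open>(0, \<mu>)\<close>, so that \<open>\<delta> = \<epsilon>\<close> witnesses equicontinuity, already with the
  generating set \<open>{f, g}\<close> itself.

  The description of the composites is expressed by the predicate \<open>rigid_at_zero\<close> below, which
  survives composition, restriction and inversion, and hence holds on the
  pseudo*group hull (\<open>rigid_hull\<close>).
\<close>

section \<open>Partial homeomorphisms as mutually inverse continuous partial maps\<close>

definition pmap_vimage :: "('a \<rightharpoonup> 'b) \<Rightarrow> 'b set \<Rightarrow> 'a set" where
  "pmap_vimage f U = {x. \<exists>y\<in>U. f x = Some y}"

text \<open>
  Phrasing continuity by preimages of the partial map itself, rather than of a total extension,
  makes composition immediate. Openness of the domain is included, as the case where the open set is
  the whole space.
\<close>

definition open_pcontinuous :: "'a topology \<Rightarrow> ('a \<rightharpoonup> 'a) \<Rightarrow> bool" where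
  "open_pcontinuous T f \<longleftrightarrow>
     ran f \<subseteq> topspace T \<and> (\<forall>U. openin T U \<longrightarrow> openin T (pmap_vimage f U))"

definition pmap_inverses :: "('a \<rightharpoonup> 'b) \<Rightarrow> ('b \<rightharpoonup> 'a) \<Rightarrow> bool" where
  "pmap_inverses f g \<longleftrightarrow> (\<forall>x y. f x = Some y \<longleftrightarrow> g y = Some x)"

lemma pmap_inverses_sym: "pmap_inverses f g \<Longrightarrow> pmap_inverses g f"
  by (auto simp: pmap_inverses_def)

lemma pmap_inverses_comp:
  "pmap_inverses f f' \<Longrightarrow> pmap_inverses g g' \<Longrightarrow> pmap_inverses (g \<circ>\<^sub>m f) (f' \<circ>\<^sub>m g')"
  by (auto simp: pmap_inverses_def map_comp_Some_iff)

lemma pmap_inverses_dom: "pmap_inverses f g \<Longrightarrow> dom g = ran f"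
  by (auto simp: pmap_inverses_def ran_def)

lemma pmap_inv_eq:
  assumes "pmap_inverses f g"
  shows "pmap_inv f = g"
proof
  fix y
  show "pmap_inv f y = g y"
  proof (cases "g y")
    case None
    then have "y \<notin> ran f"
      using assms by (auto simp: pmap_inverses_def ran_def)
    with None show ?thesis
      by (simp add: pmap_inv_def)
  next
    case (Some x)
    then have "f z = Some y \<longleftrightarrow> z = x" for z
      using assms by (auto simp: pmap_inverses_def)
    with Some show ?thesis
      by (auto simp: pmap_inv_def ran_def)
  qed
qed

lemma open_pcontinuous_dom:
  assumes "open_pcontinuous T f"
  shows "openin T (dom f)"
proof -
  have "pmap_vimage f (topspace T) = dom f"
    using assms unfolding open_pcontinuous_def pmap_vimage_def by (fastforce simp: ran_def)
  moreover have "openin T (pmap_vimage f (topspace T))"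
    using assms by (simp add: open_pcontinuous_def)
  ultimately show ?thesis
    by simp
qed

lemma open_pcontinuous_iff:
  "open_pcontinuous T f \<longleftrightarrow>
     openin T (dom f) \<and> continuous_map (subtopology T (dom f)) T (\<lambda>x. the (f x))"
    (is "?L \<longleftrightarrow> ?R")
proof
  assume L: ?L
  then have od: "openin T (dom f)"
    by (rule open_pcontinuous_dom)
  then have ts: "topspace (subtopology T (dom f)) = dom f"
    using openin_subset by fastforce
  have "openin (subtopology T (dom f)) {x \<in> dom f. the (f x) \<in> U}" if "openin T U" for U
  proof -
    have "{x \<in> dom f. the (f x) \<in> U} = pmap_vimage f U"
      by (auto simp: pmap_vimage_def)
    with L that show ?thesis
      by (auto simp: open_pcontinuous_def openin_open_subtopology[OF od] pmap_vimage_def)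
  qed
  moreover have "the (f x) \<in> topspace T" if "x \<in> dom f" for x
    using L that by (auto simp: open_pcontinuous_def ran_def)
  ultimately show ?R
    using od by (auto simp: continuous_map_def ts simp del: topspace_subtopology)
next
  assume R: ?R
  then have od: "openin T (dom f)"
    by simp
  then have ts: "topspace (subtopology T (dom f)) = dom f"
    using openin_subset by fastforce
  have "openin T (pmap_vimage f U)" if "openin T U" for U
  proof -
    have "pmap_vimage f U = {x \<in> dom f. the (f x) \<in> U}"
      by (auto simp: pmap_vimage_def)
    with R that show ?thesis
      by (auto simp: continuous_map_def ts openin_open_subtopology[OF od] simp del: topspace_subtopology)
  qed
  moreover have "ran f \<subseteq> topspace T"
  proof
    fix y assume "y \<in> ran f"
    then obtain x where "f x = Some y"
      by (auto simp: ran_def)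
    with R show "y \<in> topspace T"
      unfolding continuous_map_def ts by force
  qed
  ultimately show ?L
    by (simp add: open_pcontinuous_def)
qed

text \<open>
  Partial homeomorphisms thus become a condition symmetric in the map and its inverse, from which
  all closure properties of the pseudo*group of partial homeomorphisms can be read off.
\<close>

lemma partial_homeos_iff:
  "f \<in> partial_homeos T \<longleftrightarrow>
     (\<exists>g. pmap_inverses f g \<and> open_pcontinuous T f \<and> open_pcontinuous T g)"
    (is "?L \<longleftrightarrow> ?R")
proof
  assume ?L
  then have od: "openin T (dom f)" and orr: "openin T (ran f)"
    and hom: "homeomorphic_map (subtopology T (dom f)) (subtopology T (ran f)) (\<lambda>x. the (f x))"
    by (auto simp: partial_homeos_def)
  have td: "topspace (subtopology T (dom f)) = dom f" and tr: "topspace (subtopology T (ran f)) = ran f"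
    using od orr openin_subset by fastforce+
  from hom obtain h where
    h: "homeomorphic_maps (subtopology T (dom f)) (subtopology T (ran f)) (\<lambda>x. the (f x)) h"
    by (auto simp: homeomorphic_map_maps)
  define g where "g = (\<lambda>y. if y \<in> ran f then Some (h y) else None)"
  have dg: "dom g = ran f"
    by (auto simp: g_def split: if_splits)
  have hf: "h (the (f x)) = x" if "x \<in> dom f" for x
    using h that by (simp only: homeomorphic_maps_def td)
  have inv: "pmap_inverses f g"
    unfolding pmap_inverses_def
  proof (intro allI iffI)
    fix x y assume "f x = Some y"
    then show "g y = Some x"
      using hf[of x] by (auto simp: g_def ran_def)
  next
    fix x y assume "g y = Some x"
    then obtain x' where "f x' = Some y" "x = h y"
      by (auto simp: g_def ran_def split: if_splits)
    then show "f x = Some y"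
      using hf[of x'] by auto
  qed
  have "continuous_map (subtopology T (dom f)) T (\<lambda>x. the (f x))"
    and "continuous_map (subtopology T (ran f)) T h"
    using h by (auto simp: homeomorphic_maps_def continuous_map_in_subtopology)
  moreover from this(2) have "continuous_map (subtopology T (dom g)) T (\<lambda>x. the (g x))"
    unfolding dg by (rule continuous_map_eq) (simp add: g_def)
  ultimately show ?R
    using inv od orr dg by (auto simp: open_pcontinuous_iff)
next
  assume ?R
  then obtain g where inv: "pmap_inverses f g"
    and f: "openin T (dom f)" "continuous_map (subtopology T (dom f)) T (\<lambda>x. the (f x))"
    and g: "openin T (dom g)" "continuous_map (subtopology T (dom g)) T (\<lambda>x. the (g x))"
    by (auto simp: open_pcontinuous_iff)
  have dg: "dom g = ran f" and df: "dom f = ran g"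
    using inv pmap_inverses_sym pmap_inverses_dom by blast+
  have gf: "the (g (the (f x))) = x" if "x \<in> dom f" for x
    using inv that unfolding pmap_inverses_def by force
  have fg: "the (f (the (g y))) = y" if "y \<in> ran f" for y
    using inv that unfolding pmap_inverses_def ran_def by force
  have f_in: "the (f x) \<in> ran f" if "x \<in> dom f" for x
    using that by (auto simp: ran_def)
  have g_in: "the (g y) \<in> dom f" if "y \<in> ran f" for y
    using that unfolding df dg[symmetric] by (auto simp: ran_def)
  have "homeomorphic_maps (subtopology T (dom f)) (subtopology T (ran f))
          (\<lambda>x. the (f x)) (\<lambda>y. the (g y))"
    unfolding homeomorphic_maps_def
    using f(2) g(2) gf fg f_in g_in by (auto simp: continuous_map_in_subtopology dg)
  then show ?L
    using f g by (auto simp: partial_homeos_def homeomorphic_map_maps dg)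
qed

lemma open_pcontinuous_comp:
  assumes "open_pcontinuous T f" "open_pcontinuous T g"
  shows "open_pcontinuous T (g \<circ>\<^sub>m f)"
proof -
  have "pmap_vimage (g \<circ>\<^sub>m f) U = pmap_vimage f (pmap_vimage g U)" for U
    by (auto simp: pmap_vimage_def map_comp_Some_iff)
  moreover have "ran (g \<circ>\<^sub>m f) \<subseteq> ran g"
    by (auto simp: ran_def map_comp_Some_iff)
  ultimately show ?thesis
    using assms by (auto simp: open_pcontinuous_def)
qed

lemma open_pcontinuous_pmap_id_restrict:
  assumes "openin T V"
  shows "open_pcontinuous T (pmap_id T |` V)"
proof -
  have "pmap_vimage (pmap_id T |` V) U = U \<inter> V" if "openin T U" for U
    using openin_subset[OF that]
    by (auto simp: pmap_vimage_def pmap_id_def restrict_map_def split: if_splits)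
  moreover have "ran (pmap_id T |` V) \<subseteq> topspace T"
    by (auto simp: ran_def pmap_id_def restrict_map_def split: if_splits)
  ultimately show ?thesis
    using assms by (auto simp: open_pcontinuous_def)
qed

lemma pmap_inverses_pmap_id_restrict: "pmap_inverses (pmap_id T |` V) (pmap_id T |` V)"
  by (auto simp: pmap_inverses_def pmap_id_def restrict_map_def split: if_splits)

lemma pmap_id_restrict_topspace: "pmap_id T |` topspace T = pmap_id T"
  by (auto simp: pmap_id_def restrict_map_def)

text \<open>With this, closure under restriction becomes an instance of closure under composition.\<close>

lemma restrict_eq_comp_pmap_id:
  assumes "openin T V"
  shows "f |` V = f \<circ>\<^sub>m (pmap_id T |` V)"
  using openin_subset[OF assms] by (auto simp: fun_eq_iff pmap_id_def restrict_map_def map_comp_def)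

lemma partial_homeos_pmap_id_restrict:
  "openin T V \<Longrightarrow> pmap_id T |` V \<in> partial_homeos T"
  using open_pcontinuous_pmap_id_restrict pmap_inverses_pmap_id_restrict
  unfolding partial_homeos_iff by blast

lemma partial_homeos_comp:
  "f \<in> partial_homeos T \<Longrightarrow> g \<in> partial_homeos T \<Longrightarrow> g \<circ>\<^sub>m f \<in> partial_homeos T"
  unfolding partial_homeos_iff by (meson open_pcontinuous_comp pmap_inverses_comp)

lemma pmap_inverses_pmap_inv:
  "f \<in> partial_homeos T \<Longrightarrow> pmap_inverses f (pmap_inv f)"
  unfolding partial_homeos_iff using pmap_inv_eq by metis

lemma partial_homeos_pmap_inv:
  "f \<in> partial_homeos T \<Longrightarrow> pmap_inv f \<in> partial_homeos T"
  unfolding partial_homeos_iff using pmap_inv_eq pmap_inverses_sym by metis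

section \<open>The open sets of the level space\<close>

lemma topspace_Ytop: "topspace Ytop = {\<alpha>. \<forall>i. \<alpha> i \<in> {0, 1}}"
  by (auto simp: Ytop_def PiE_def Pi_def)

lemma zero_cyl_subset_Ytop: "zero_cyl n \<subseteq> topspace Ytop"
  by (auto simp: zero_cyl_def)

lemma zero_cyl_antimono: "m \<le> n \<Longrightarrow> zero_cyl n \<subseteq> zero_cyl m"
  by (auto simp: zero_cyl_def)

lemma zero_seq_in_zero_cyl: "zero_seq \<in> zero_cyl n"
  by (auto simp: zero_cyl_def zero_seq_def topspace_Ytop)

lemma continuous_map_Ytop_reindex: "continuous_map Ytop Ytop (\<lambda>\<alpha> i. \<alpha> (h i))"
  unfolding Ytop_def continuous_map_componentwise_UNIV
  by (auto intro: continuous_map_product_projection)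

lemma continuous_map_Ytop_coord: "continuous_map Ytop (discrete_topology {0, 1}) (\<lambda>\<alpha>. \<alpha> i)"
  unfolding Ytop_def by (rule continuous_map_product_projection) simp

lemma openin_Ytop_reindex_vimage:
  "openin Ytop U \<Longrightarrow> openin Ytop {\<alpha> \<in> topspace Ytop. (\<lambda>i. \<alpha> (h i)) \<in> U}"
  by (rule openin_continuous_map_preimage[OF continuous_map_Ytop_reindex])

lemma
  shows openin_zero_cyl: "openin Ytop (zero_cyl n)"
    and closedin_zero_cyl: "closedin Ytop (zero_cyl n)"
proof -
  define C where "C i = {\<alpha> \<in> topspace Ytop. \<alpha> i \<in> {0}}" for i
  have eq: "zero_cyl n = topspace Ytop \<inter> \<Inter> (C ` {- int n<..<int n})"
    by (force simp: zero_cyl_def C_def abs_less_iff)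
  have "openin Ytop (C i)" for i
    unfolding C_def by (rule openin_continuous_map_preimage[OF continuous_map_Ytop_coord]) simp
  then show "openin Ytop (zero_cyl n)"
    unfolding eq by (cases "{- int n<..<int n} = {}") (auto intro!: openin_Int openin_INT)
  have "closedin Ytop (C i)" for i
    unfolding C_def by (rule closedin_continuous_map_preimage[OF continuous_map_Ytop_coord]) simp
  then show "closedin Ytop (zero_cyl n)"
    unfolding eq by (cases "{- int n<..<int n} = {}") (auto intro!: closedin_Int closedin_INT)
qed

lemma topspace_Xtop: "topspace Xtop = {(n, \<alpha>). \<alpha> \<in> zero_cyl n}"
  using zero_cyl_subset_Ytop by (auto simp: Xtop_def)

text \<open>The index space is discrete and each cylinder is open, so openness can be tested level by level.\<close>

lemma openin_Xtop_iff:
  "openin Xtop A \<longleftrightarrow> A \<subseteq> topspace Xtop \<and> (\<forall>n. openin Ytop {\<alpha>. (n, \<alpha>) \<in> A})"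
    (is "?L \<longleftrightarrow> ?R")
proof
  assume L: ?L
  then obtain W where W: "openin (prod_topology (discrete_topology UNIV) Ytop) W"
    and A: "A = W \<inter> {(n, \<alpha>). \<alpha> \<in> zero_cyl n}"
    by (auto simp: Xtop_def openin_subtopology)
  have "openin Ytop {\<alpha>. (n, \<alpha>) \<in> A}" for n
  proof -
    have "continuous_map Ytop (prod_topology (discrete_topology UNIV) Ytop) (\<lambda>\<alpha>. (n, \<alpha>))"
      by (simp add: continuous_map_pairwise o_def)
    from openin_continuous_map_preimage[OF this W]
    have "openin Ytop ({\<alpha> \<in> topspace Ytop. (n, \<alpha>) \<in> W} \<inter> zero_cyl n)"
      using openin_zero_cyl by (rule openin_Int)
    moreover have "{\<alpha> \<in> topspace Ytop. (n, \<alpha>) \<in> W} \<inter> zero_cyl n = {\<alpha>. (n, \<alpha>) \<in> A}"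
      using zero_cyl_subset_Ytop by (auto simp: A)
    ultimately show ?thesis
      by simp
  qed
  then show ?R
    using openin_subset[OF L] by blast
next
  assume R: ?R
  have "openin (prod_topology (discrete_topology UNIV) Ytop) ({n} \<times> {\<alpha>. (n, \<alpha>) \<in> A})" for n
    using R by (simp add: openin_prod_Times_iff)
  then have "openin (prod_topology (discrete_topology UNIV) Ytop) (\<Union>n. {n} \<times> {\<alpha>. (n, \<alpha>) \<in> A})"
    by blast
  moreover have "(\<Union>n. {n} \<times> {\<alpha>. (n, \<alpha>) \<in> A}) = A"
    by auto
  ultimately have "openin (prod_topology (discrete_topology UNIV) Ytop) A"
    by simp
  then show ?L
    using R topspace_Xtop unfolding Xtop_def openin_subtopology by blast
qed

section \<open>The generators are partial homeomorphisms\<close>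

lemma open_pcontinuous_XtopI:
  assumes "ran f \<subseteq> topspace Xtop" "dom f \<subseteq> topspace Xtop"
    and "\<And>U n. openin Xtop U \<Longrightarrow> openin Ytop {\<alpha>. (n, \<alpha>) \<in> pmap_vimage f U}"
  shows "open_pcontinuous Xtop f"
proof -
  have "pmap_vimage f U \<subseteq> dom f" for U
    by (auto simp: pmap_vimage_def)
  with assms show ?thesis
    by (force simp: open_pcontinuous_def openin_Xtop_iff[of "pmap_vimage f _"])
qed

definition unshift :: "(int \<Rightarrow> nat) \<Rightarrow> (int \<Rightarrow> nat)" where
  "unshift \<alpha> = (\<lambda>i. \<alpha> (i - 1))"

lemma unshift_shift [simp]: "unshift (shift \<alpha>) = \<alpha>"
  by (simp add: shift_def unshift_def)

lemma shift_unshift [simp]: "shift (unshift \<alpha>) = \<alpha>"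
  by (simp add: shift_def unshift_def)

lemma shift_map_partial_homeo: "shift_map \<in> partial_homeos Xtop"
proof -
  define g where "g = (\<lambda>(n, \<beta>).
    if \<beta> \<in> zero_cyl n - zero_cyl (n + 2) \<and> unshift \<beta> \<in> zero_cyl n
    then Some (n, unshift \<beta>) else None)"
  have inv: "pmap_inverses shift_map g"
    by (auto simp: pmap_inverses_def shift_map_def g_def topspace_Xtop split: if_splits)
  have f: "open_pcontinuous Xtop shift_map"
  proof (rule open_pcontinuous_XtopI)
    fix U n assume "openin Xtop U"
    define V where "V = {\<alpha>. (n, \<alpha>) \<in> U} \<inter> (zero_cyl n - zero_cyl (n + 2))"
    from \<open>openin Xtop U\<close> have "openin Ytop V"
      unfolding V_def by (intro openin_Int openin_diff openin_zero_cyl closedin_zero_cyl)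
        (simp add: openin_Xtop_iff)
    then have "openin Ytop (zero_cyl n \<inter> {\<alpha> \<in> topspace Ytop. shift \<alpha> \<in> V})"
      unfolding shift_def by (intro openin_Int openin_zero_cyl openin_Ytop_reindex_vimage)
    moreover have "zero_cyl n \<inter> {\<alpha> \<in> topspace Ytop. shift \<alpha> \<in> V}
        = {\<alpha>. (n, \<alpha>) \<in> pmap_vimage shift_map U}"
      using zero_cyl_subset_Ytop
      by (auto simp: V_def pmap_vimage_def shift_map_def topspace_Xtop split: if_splits)
    ultimately show "openin Ytop {\<alpha>. (n, \<alpha>) \<in> pmap_vimage shift_map U}"
      by simp
  qed (auto simp: shift_map_def topspace_Xtop ran_def split: if_splits)
  have g: "open_pcontinuous Xtop g"
  proof (rule open_pcontinuous_XtopI)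
    fix U n assume "openin Xtop U"
    define V where "V = {\<alpha>. (n, \<alpha>) \<in> U} \<inter> zero_cyl n"
    from \<open>openin Xtop U\<close> have "openin Ytop V"
      unfolding V_def by (intro openin_Int openin_zero_cyl) (simp add: openin_Xtop_iff)
    then have "openin Ytop ((zero_cyl n - zero_cyl (n + 2)) \<inter> {\<alpha> \<in> topspace Ytop. unshift \<alpha> \<in> V})"
      unfolding unshift_def
      by (intro openin_Int openin_diff openin_zero_cyl closedin_zero_cyl openin_Ytop_reindex_vimage)
    moreover have "(zero_cyl n - zero_cyl (n + 2)) \<inter> {\<alpha> \<in> topspace Ytop. unshift \<alpha> \<in> V}
        = {\<alpha>. (n, \<alpha>) \<in> pmap_vimage g U}"
      using zero_cyl_subset_Ytop by (auto simp: V_def pmap_vimage_def g_def split: if_splits)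
    ultimately show "openin Ytop {\<alpha>. (n, \<alpha>) \<in> pmap_vimage g U}"
      by simp
  qed (auto simp: g_def topspace_Xtop ran_def split: if_splits)
  from inv f g show ?thesis
    by (auto simp: partial_homeos_iff)
qed

lemma lift_map_partial_homeo: "lift_map \<in> partial_homeos Xtop"
proof -
  define g where "g = (\<lambda>(n, \<beta>::int \<Rightarrow> nat).
    if 0 < n \<and> \<beta> \<in> zero_cyl n then Some (n - 1, \<beta>) else None)"
  have mono: "\<beta> \<in> zero_cyl n" if "\<beta> \<in> zero_cyl (Suc n)" for \<beta> n
    using that zero_cyl_antimono[of n "Suc n"] by auto
  have inv: "pmap_inverses lift_map g"
    using mono by (auto simp: pmap_inverses_def lift_map_def g_def topspace_Xtop split: if_splits)
  have f: "open_pcontinuous Xtop lift_map"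
  proof (rule open_pcontinuous_XtopI)
    fix U n assume "openin Xtop U"
    then have "openin Ytop ({\<alpha>. (n + 1, \<alpha>) \<in> U} \<inter> zero_cyl (n + 1))"
      by (intro openin_Int openin_zero_cyl) (simp add: openin_Xtop_iff)
    moreover have "{\<alpha>. (n + 1, \<alpha>) \<in> U} \<inter> zero_cyl (n + 1) = {\<alpha>. (n, \<alpha>) \<in> pmap_vimage lift_map U}"
      using mono by (auto simp: pmap_vimage_def lift_map_def topspace_Xtop split: if_splits)
    ultimately show "openin Ytop {\<alpha>. (n, \<alpha>) \<in> pmap_vimage lift_map U}"
      by simp
  qed (auto simp: lift_map_def topspace_Xtop ran_def split: if_splits)
  have g: "open_pcontinuous Xtop g"
  proof (rule open_pcontinuous_XtopI)
    fix U n assume U: "openin Xtop U"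
    show "openin Ytop {\<alpha>. (n, \<alpha>) \<in> pmap_vimage g U}"
    proof (cases "n = 0")
      case True
      then show ?thesis
        by (simp add: pmap_vimage_def g_def)
    next
      case False
      have "openin Ytop ({\<alpha>. (n - 1, \<alpha>) \<in> U} \<inter> zero_cyl n)"
        using U by (intro openin_Int openin_zero_cyl) (simp add: openin_Xtop_iff)
      moreover have "{\<alpha>. (n - 1, \<alpha>) \<in> U} \<inter> zero_cyl n = {\<alpha>. (n, \<alpha>) \<in> pmap_vimage g U}"
        using False by (auto simp: pmap_vimage_def g_def split: if_splits)
      ultimately show ?thesis
        by simp
    qed
  next
    show "ran g \<subseteq> topspace Xtop"
    proof
      fix p assume "p \<in> ran g"
      then obtain n \<beta> where "0 < n" "\<beta> \<in> zero_cyl n" "p = (n - 1, \<beta>)"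
        by (auto simp: g_def ran_def split: if_splits)
      then show "p \<in> topspace Xtop"
        using zero_cyl_antimono[of "n - 1" n] by (auto simp: topspace_Xtop)
    qed
  qed (auto simp: g_def topspace_Xtop split: if_splits)
  from inv f g show ?thesis
    by (auto simp: partial_homeos_iff)
qed

section \<open>Rigidity along the zero sequence\<close>

definition on_zero_level :: "nat \<times> (int \<Rightarrow> nat) \<Rightarrow> nat \<times> (int \<Rightarrow> nat) \<Rightarrow> bool" where
  "on_zero_level p q \<longleftrightarrow> snd p = zero_seq \<and> fst q = fst p"

text \<open>
  What matters is that \<open>s\<close> moves the level of a zero point as a whole and keeps all sequences on it.
  The equivalence, instead of one implication, makes the condition pass to the inverse of \<open>s\<close>.
\<close>

definition rigid_at_zero :: "(nat \<times> (int \<Rightarrow> nat) \<rightharpoonup> nat \<times> (int \<Rightarrow> nat)) \<Rightarrow> bool" where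
  "rigid_at_zero s \<longleftrightarrow>
     (\<forall>p q p' q'. s p = Some p' \<and> s q = Some q' \<longrightarrow>
        (on_zero_level p q \<longleftrightarrow> on_zero_level p' q') \<and> (on_zero_level p q \<longrightarrow> snd q' = snd q))"

text \<open>Vacuously: neither the domain nor the image of the shift contains a zero point.\<close>

lemma rigid_shift_map: "rigid_at_zero shift_map"
proof -
  have "snd p \<noteq> zero_seq \<and> snd p' \<noteq> zero_seq" if s: "shift_map p = Some p'" for p p'
  proof -
    have p': "snd p' = shift (snd p)" "snd p' \<notin> zero_cyl (fst p + 2)"
      using s by (auto simp: shift_map_def split: if_splits prod.splits)
    then have ne: "snd p' \<noteq> zero_seq"
      using zero_seq_in_zero_cyl by metis
    moreover have "shift zero_seq = zero_seq"
      by (simp add: shift_def zero_seq_def)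
    ultimately show ?thesis
      using p'(1) by metis
  qed
  then show ?thesis
    unfolding rigid_at_zero_def on_zero_level_def by blast
qed

lemma rigid_lift_map: "rigid_at_zero lift_map"
  by (auto simp: rigid_at_zero_def on_zero_level_def lift_map_def split: if_splits)

lemma rigid_pmap_id_restrict: "rigid_at_zero (pmap_id T |` V)"
  by (auto simp: rigid_at_zero_def pmap_id_def restrict_map_def split: if_splits)

lemma rigid_at_zeroD:
  assumes "rigid_at_zero s" "s p = Some p'" "s q = Some q'"
  shows "on_zero_level p q \<longleftrightarrow> on_zero_level p' q'"
    and "on_zero_level p q \<Longrightarrow> snd q' = snd q"
  using assms unfolding rigid_at_zero_def by blast+

lemma rigid_comp:
  assumes f: "rigid_at_zero f" and g: "rigid_at_zero g"
  shows "rigid_at_zero (g \<circ>\<^sub>m f)"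
  unfolding rigid_at_zero_def
proof (intro allI impI)
  fix p q p' q' assume "(g \<circ>\<^sub>m f) p = Some p' \<and> (g \<circ>\<^sub>m f) q = Some q'"
  then obtain a b where "f p = Some a" "g a = Some p'" "f q = Some b" "g b = Some q'"
    by (auto simp: map_comp_Some_iff)
  then show "(on_zero_level p q \<longleftrightarrow> on_zero_level p' q') \<and> (on_zero_level p q \<longrightarrow> snd q' = snd q)"
    using rigid_at_zeroD[OF f, of p a q b] rigid_at_zeroD[OF g, of a p' b q'] by simp
qed

lemma rigid_inverse:
  assumes inv: "pmap_inverses f g" and f: "rigid_at_zero f"
  shows "rigid_at_zero g"
  unfolding rigid_at_zero_def
proof (intro allI impI)
  fix p q p' q' assume "g p = Some p' \<and> g q = Some q'"
  then have "f p' = Some p" "f q' = Some q"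
    using inv unfolding pmap_inverses_def by blast+
  then show "(on_zero_level p q \<longleftrightarrow> on_zero_level p' q') \<and> (on_zero_level p q \<longrightarrow> snd q' = snd q)"
    using rigid_at_zeroD[OF f, of p' p q' q] by simp
qed

lemma pseudostargroup_rigid:
  "pseudostargroup T {s \<in> partial_homeos T. rigid_at_zero s}"
proof -
  let ?G = "{s \<in> partial_homeos T. rigid_at_zero s}"
  have id: "pmap_id T |` U \<in> ?G" if "openin T U" for U
    using that by (simp add: partial_homeos_pmap_id_restrict rigid_pmap_id_restrict)
  have comp: "g \<circ>\<^sub>m f \<in> ?G" if "f \<in> ?G" "g \<in> ?G" for f g
    using that by (simp add: partial_homeos_comp rigid_comp)
  have "f |` U \<in> ?G" if "f \<in> ?G" "openin T U" for f U
    using comp[OF id[OF that(2)] that(1)] restrict_eq_comp_pmap_id[OF that(2)] by metis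
  moreover have "pmap_inv f \<in> ?G" if "f \<in> ?G" for f
    using that partial_homeos_pmap_inv pmap_inverses_pmap_inv rigid_inverse by blast
  moreover have "pmap_id T \<in> ?G"
    using id[OF openin_topspace] by (simp add: pmap_id_restrict_topspace)
  ultimately show ?thesis
    using comp unfolding pseudostargroup_def by blast
qed

lemma rigid_hull:
  assumes "s \<in> pseudostargroup Xtop hull {shift_map, lift_map}"
  shows "rigid_at_zero s"
proof -
  have "{shift_map, lift_map} \<subseteq> {s \<in> partial_homeos Xtop. rigid_at_zero s}"
    using shift_map_partial_homeo lift_map_partial_homeo rigid_shift_map rigid_lift_map by blast
  from hull_minimal[where S = "pseudostargroup Xtop", OF this pseudostargroup_rigid] assms
  show ?thesis
    by blast
qed

section \<open>The levelwise metric\<close>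

definition level_dist :: "('b \<Rightarrow> 'b \<Rightarrow> real) \<Rightarrow> 'a \<times> 'b \<Rightarrow> 'a \<times> 'b \<Rightarrow> ennreal" where
  "level_dist m p q = (if fst p = fst q then ennreal (m (snd p) (snd q)) else \<infinity>)"

lemma metrizable_Ytop: "metrizable_space Ytop"
  unfolding Ytop_def metrizable_space_product_topology
  by (auto simp: metrizable_space_discrete_topology)

lemma extended_metric_level_dist:
  assumes "Metric_space M m" and "snd ` X \<subseteq> M"
  shows "extended_metric X (level_dist m)"
proof -
  interpret Metric_space M m
    by (rule assms(1))
  have M: "snd p \<in> M" if "p \<in> X" for p
    using assms(2) that by blast
  have "level_dist m p q = 0 \<longleftrightarrow> p = q" if "p \<in> X" "q \<in> X" for p q
  proof -
    have "m (snd p) (snd q) \<le> 0 \<longleftrightarrow> snd p = snd q"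
      using zero[OF M[OF that(1)] M[OF that(2)]] nonneg[of "snd p" "snd q"] by linarith
    then show ?thesis
      by (simp add: level_dist_def prod_eq_iff ennreal_eq_0_iff)
  qed
  moreover have "level_dist m p q = level_dist m q p" for p q
    unfolding level_dist_def by (metis commute)
  moreover have "level_dist m p r \<le> level_dist m p q + level_dist m q r"
    if "p \<in> X" "q \<in> X" "r \<in> X" for p q r
  proof -
    have "ennreal (m (snd p) (snd r)) \<le> ennreal (m (snd p) (snd q)) + ennreal (m (snd q) (snd r))"
      using ennreal_leI[OF triangle[OF M[OF that(1)] M[OF that(2)] M[OF that(3)]]]
      by (subst (asm) ennreal_plus) (simp_all only: nonneg)
    then show ?thesis
      by (simp add: level_dist_def)
  qed
  ultimately show ?thesis
    unfolding extended_metric_def by blast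
qed

text \<open>
  A ball around \<open>(n, \<alpha>)\<close> of finite radius is the trace on \<open>zero_cyl n\<close> of a ball of \<open>Y\<close>,
  placed at the level \<open>n\<close>; these sets form a basis because openness can be tested level by level.
\<close>

lemma compatible_level_dist:
  assumes "Metric_space M m" and Y: "Metric_space.mtopology M m = Ytop"
  shows "compatible_metric Xtop (level_dist m)"
proof -
  interpret Metric_space M m
    by (rule assms(1))
  have M: "\<alpha> \<in> M" if "\<alpha> \<in> zero_cyl n" for \<alpha> n
    using that zero_cyl_subset_Ytop topspace_mtopology[unfolded Y] by blast
  define B where "B p r = {q \<in> topspace Xtop. level_dist m p q < ennreal r}" for p r
  define \<B> where "\<B> = {B p r | p r. p \<in> topspace Xtop \<and> (0::real) < r}"
  have slice: "(k, \<beta>) \<in> B (n, \<alpha>) r \<longleftrightarrow> k = n \<and> \<beta> \<in> zero_cyl n \<inter> mball \<alpha> r"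
    if "\<alpha> \<in> zero_cyl n" "0 < r" for k \<beta> n \<alpha> r
    using that M by (auto simp: B_def level_dist_def topspace_Xtop ennreal_less_iff)
  have ball_open: "openin Xtop (B (n, \<alpha>) r)" if "\<alpha> \<in> zero_cyl n" "0 < r" for n \<alpha> r
  proof -
    have "openin Ytop {\<beta>. (k, \<beta>) \<in> B (n, \<alpha>) r}" for k
    proof (cases "k = n")
      case True
      then have "{\<beta>. (k, \<beta>) \<in> B (n, \<alpha>) r} = zero_cyl n \<inter> mball \<alpha> r"
        using slice[OF that] by auto
      then show ?thesis
        using openin_mball[of \<alpha> r] Y by (simp add: openin_Int openin_zero_cyl)
    next
      case False
      then show ?thesis
        using slice[OF that] by simp
    qed
    then show ?thesis
      by (auto simp: openin_Xtop_iff B_def)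
  qed
  have "openin Xtop U" if "openin (topology_generated_by \<B>) U" for U
  proof -
    have "generate_topology_on \<B> U"
      using that by (simp add: openin_topology_generated_by_iff)
    then show ?thesis
    proof induction
      case (Basis s)
      then show ?case
        using ball_open by (auto simp: \<B>_def topspace_Xtop)
    qed (simp_all add: openin_Int openin_Union)
  qed
  moreover have "openin (topology_generated_by \<B>) U" if U: "openin Xtop U" for U
  proof (subst openin_subopen, intro ballI)
    fix p assume p: "p \<in> U"
    obtain n \<alpha> where na: "p = (n, \<alpha>)"
      by fastforce
    have \<alpha>: "\<alpha> \<in> zero_cyl n"
      using p openin_subset[OF U] na by (auto simp: topspace_Xtop)
    have "openin mtopology {\<beta>. (n, \<beta>) \<in> U}"
      using U Y by (simp add: openin_Xtop_iff)
    then obtain r where r: "0 < r" "mball \<alpha> r \<subseteq> {\<beta>. (n, \<beta>) \<in> U}"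
      using p na unfolding openin_mtopology by blast
    have "B p r \<subseteq> U"
      using r slice[OF \<alpha> r(1)] na by auto
    moreover have "p \<in> B p r"
      using slice[OF \<alpha> r(1), of n \<alpha>] na r(1) \<alpha> M[OF \<alpha>] by simp
    moreover have "openin (topology_generated_by \<B>) (B p r)"
      by (rule topology_generated_by_Basis) (use r \<alpha> na in \<open>auto simp: \<B>_def topspace_Xtop\<close>)
    ultimately show "\<exists>V. openin (topology_generated_by \<B>) V \<and> p \<in> V \<and> V \<subseteq> U"
      by blast
  qed
  ultimately have "topology_generated_by \<B> = Xtop"
    unfolding topology_eq by blast
  moreover have "extended_metric (topspace Xtop) (level_dist m)"
    using M by (intro extended_metric_level_dist[OF assms(1)]) (auto simp: topspace_Xtop)
  ultimately show ?thesis
    unfolding compatible_metric_def \<B>_def B_def by blast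
qed

section \<open>Equicontinuity at the zero point of level zero\<close>

theorem lemma3p23:
  shows "equicontinuity_point Xtop (pseudogroup Xtop hull {shift_map, lift_map}) (0, zero_seq)"
proof -
  let ?S = "{shift_map, lift_map}" and ?o = "(0, zero_seq) :: nat \<times> (int \<Rightarrow> nat)"
  obtain M m where m: "Metric_space M m" "Ytop = Metric_space.mtopology M m"
    using metrizable_Ytop by (auto simp: metrizable_space_def)
  have iso: "level_dist m (the (s ?o)) (the (s y)) = level_dist m ?o y"
    if s: "s \<in> pseudostargroup Xtop hull ?S" and doms: "?o \<in> dom s" "y \<in> dom s"
      and "fst y = 0" for s y
  proof -
    obtain p q where pq: "s ?o = Some p" "s y = Some q"
      using doms by blast
    have "on_zero_level ?o y"
      using that by (simp add: on_zero_level_def)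
    then have "on_zero_level p q" "snd q = snd y"
      using rigid_at_zeroD[OF rigid_hull[OF s] pq] by auto
    then show ?thesis
      using pq that by (simp add: level_dist_def on_zero_level_def)
  qed
  have "equicontinuous_wrt Xtop ?S (level_dist m) ?o"
    unfolding equicontinuous_wrt_def
  proof (intro allI impI)
    fix \<epsilon> :: real assume "0 < \<epsilon>"
    moreover have "level_dist m (the (s ?o)) (the (s y)) < ennreal \<epsilon>"
      if "s \<in> pseudostargroup Xtop hull ?S" "?o \<in> dom s" "y \<in> dom s"
        "level_dist m ?o y < ennreal \<epsilon>" for s y
    proof -
      (* A finite distance forces y onto the level of the base point. *)
      have "fst y = 0"
        using that(4) by (auto simp: level_dist_def split: if_splits)
      with iso that show ?thesis
        by metis
    qed
    ultimately show "\<exists>\<delta>>0. \<forall>s\<in>pseudostargroup Xtop hull ?S. \<forall>y\<in>topspace Xtop.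
        ?o \<in> dom s \<and> y \<in> dom s \<and> level_dist m ?o y < ennreal \<delta> \<longrightarrow>
        level_dist m (the (s ?o)) (the (s y)) < ennreal \<epsilon>"
      by blast
  qed
  moreover have "generates Xtop ?S (pseudogroup Xtop hull ?S)"
    using shift_map_partial_homeo lift_map_partial_homeo by (simp add: generates_def)
  moreover have "compatible_metric Xtop (level_dist m)"
    by (rule compatible_level_dist[OF m(1) m(2)[symmetric]])
  moreover have "?o \<in> topspace Xtop"
    using zero_seq_in_zero_cyl by (simp add: topspace_Xtop)
  ultimately show ?thesis
    unfolding equicontinuity_point_def by blast
qed

end
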